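(* Let the density $p$ be a function of bounded variation on $\mathbb{R}$, $V=\mathbf{V}(p)<\infty$. If $h=h_n=h_0/(\sqrt n\,\log n)$ for some constant $h_0>0$, then for all $n\ge16$ the kernel estimator satisfies $$\mathrm{MISE}(p_{n,h})\le\frac{\log^2n}{\sqrt n}\Bigl[\frac{4\sqrt2}{\pi}\max\{\sqrt{\mu_1(K)},\mu_1(K)\}\,\max\{V^{3/2},V^2\}\,\max\{\sqrt{h_0},h_0\}+\frac{R(K)}{h_0\log n}\Bigr].$$
   Context: Let $X_1,\dots,X_n$ be i.i.d. real random variables with probability density $p$ (not assumed differentiable or continuous). The kernel $K$ is a square integrable probability density on $\mathbb{R}$. For a bandwidth $h>0$ set $K_h(x)=h^{-1}K(h^{-1}x)$ and $p_{n,h}(x)=\frac1n\sum_{j=1}^nK_h(x-X_j)$. Define $\mathrm{MISE}(p_{n,h})=\mathrm{E}\int\{p_{n,h}(x)-p(x)\}^2\,dx$. Notation: $\mu_1(K)=\int|x|K(x)\,dx$ and $R(K)=\int K^2(x)\,dx$ (assumed finite); $\mathbf{V}(g)$ is the total variation of $g$ over the whole real line; $\log$ is the natural logarithm and $\log^2n=(\log n)^2$. *)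

theory Defs
  imports "HOL-Probability.Probability"
begin

text \<open>Densities are taken with respect to Lebesgue measure and are everywhere defined functions.
  This matters for the total variation below, which depends on the pointwise values.\<close>

definition prob_density :: "(real \<Rightarrow> real) \<Rightarrow> bool" where
  "prob_density f \<longleftrightarrow>
     f \<in> borel_measurable borel \<and> (\<forall>x. 0 \<le> f x) \<and> (\<integral>\<^sup>+ x. ennreal (f x) \<partial>lborel) = 1"

definition iid_density :: "'a measure \<Rightarrow> nat \<Rightarrow> (nat \<Rightarrow> 'a \<Rightarrow> real) \<Rightarrow> (real \<Rightarrow> real) \<Rightarrow> bool" where
  "iid_density M n X p \<longleftrightarrow>
     prob_space.indep_vars M (\<lambda>_. borel) X {1..n} \<and>
     (\<forall>j\<in>{1..n}. distributed M lborel (X j) (\<lambda>x. ennreal (p x)))"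

definition scaled_kernel :: "(real \<Rightarrow> real) \<Rightarrow> real \<Rightarrow> real \<Rightarrow> real" where
  "scaled_kernel K h x = inverse h * K (inverse h * x)"

definition kernel_estimator ::
    "(real \<Rightarrow> real) \<Rightarrow> nat \<Rightarrow> real \<Rightarrow> (nat \<Rightarrow> 'a \<Rightarrow> real) \<Rightarrow> 'a \<Rightarrow> real \<Rightarrow> real" where
  "kernel_estimator K n h X \<omega> x = (1 / real n) * (\<Sum>j=1..n. scaled_kernel K h (x - X j \<omega>))"

text \<open>The integrand is nonnegative, so the mean integrated squared error is defined as a value in
  the extended nonnegative reals; no integrability has to be presupposed, and a finite bound on it
  includes the claim that it is finite.\<close>

definition MISE :: "'a measure \<Rightarrow> ('a \<Rightarrow> real \<Rightarrow> real) \<Rightarrow> (real \<Rightarrow> real) \<Rightarrow> ennreal" where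
  "MISE M q p = (\<integral>\<^sup>+ \<omega>. (\<integral>\<^sup>+ x. ennreal ((q \<omega> x - p x)\<^sup>2) \<partial>lborel) \<partial>M)"

definition abs_moment1 :: "(real \<Rightarrow> real) \<Rightarrow> real" where
  "abs_moment1 K = (\<integral>x. \<bar>x\<bar> * K x \<partial>lborel)"

definition roughness :: "(real \<Rightarrow> real) \<Rightarrow> real" where
  "roughness K = (\<integral>x. (K x)\<^sup>2 \<partial>lborel)"

text \<open>Supremum over all finite grids \<open>t 0 \<le> \<dots> \<le> t m\<close>; repeated grid points contribute nothing.\<close>

definition total_variation :: "(real \<Rightarrow> real) \<Rightarrow> ennreal" where
  "total_variation f =
     (SUP (m, t) \<in> {(m, t). mono (t :: nat \<Rightarrow> real)}. \<Sum>i<m. ennreal \<bar>f (t (Suc i)) - f (t i)\<bar>)"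

end

theory Submission
  imports Defs
begin

text \<open>The variance of the estimator contributes at most \<open>R(K)/(nh)\<close>. For the bias no Fourier analysis
  is needed: by Jensen's inequality for the probability density \<open>K\<close>, the squared bias at \<open>x\<close> is at
  most \<open>\<integral> K(u) (p(x - hu) - p(x))\<^sup>2 du\<close>. An increment of \<open>p\<close> is bounded pointwise by \<open>V\<close>, while the
  integral over \<open>x\<close> of the absolute increment of step \<open>t\<close> is at most \<open>V\<bar>t\<bar>\<close>. So the integrated squared
  bias is at most \<open>V\<^sup>2 h \<mu>\<^sub>1(K)\<close>, which for the given bandwidth is smaller than the
  claimed bound by a factor of at least \<open>log\<^sup>3 n\<close>.\<close>

section \<open>Total variation and increments of a fixed step\<close>

lemma grid_sum_le_total_variation:
  assumes "mono t"
  shows "(\<Sum>i<m. ennreal \<bar>f (t (Suc i)) - f (t i)\<bar>) \<le> total_variation f"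
  unfolding total_variation_def by (rule SUP_upper2[of "(m, t)"]) (use assms in auto)

lemma abs_diff_le_total_variation: "ennreal \<bar>f x - f y\<bar> \<le> total_variation f"
proof -
  \<comment> \<open>A grid with a single step suffices; continuing it with the constant value
    \<open>b\<close> keeps it monotone on all naturals.\<close>
  have *: "ennreal \<bar>f b - f a\<bar> \<le> total_variation f" if "a \<le> b" for a b
    using grid_sum_le_total_variation[where t = "\<lambda>i. if i = 0 then a else b" and f = f and m = 1] that
    by (auto simp: mono_def)
  show ?thesis
    using *[of x y] *[of y x] by (cases "x \<le> y") (auto simp: abs_minus_commute)
qed

text \<open>By induction on \<open>m\<close>: the last cell of length \<open>t\<close> is translated
  back by \<open>m * t\<close> onto the first one. Half-open cells make the union disjoint, so the
  integrals add exactly.\<close>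

lemma nn_integral_interval_split:
  fixes f :: "real \<Rightarrow> ennreal"
  assumes [measurable]: "f \<in> borel_measurable borel" and "0 \<le> t"
  shows "(\<integral>\<^sup>+x \<in> {a..<a + real m * t}. f x \<partial>lborel)
    = (\<integral>\<^sup>+x \<in> {a..<a + t}. (\<Sum>k<m. f (x + real k * t)) \<partial>lborel)"
proof (induction m)
  case 0
  then show ?case by simp
next
  case (Suc m)
  define b where "b = a + real m * t"
  have le: "a \<le> b" using \<open>0 \<le> t\<close> by (simp add: b_def)
  have "a + real (Suc m) * t = b + t" by (simp add: b_def algebra_simps)
  then have split: "{a..<a + real (Suc m) * t} = {a..<b} \<union> {b..<b + t}"
    using le \<open>0 \<le> t\<close> by auto
  have shift: "(\<integral>\<^sup>+x \<in> {b..<b + t}. f x \<partial>lborel)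
      = (\<integral>\<^sup>+x \<in> {a..<a + t}. f (x + real m * t) \<partial>lborel)"
    by (subst nn_integral_real_affine[where c = 1 and t = "real m * t"])
       (auto simp: b_def indicator_def add_ac intro!: nn_integral_cong)
  have "(\<integral>\<^sup>+x \<in> {a..<a + real (Suc m) * t}. f x \<partial>lborel)
      = (\<integral>\<^sup>+x \<in> {a..<b}. f x \<partial>lborel) + (\<integral>\<^sup>+x \<in> {b..<b + t}. f x \<partial>lborel)"
    unfolding split by (rule nn_integral_disjoint_pair) auto
  also have "\<dots> = (\<integral>\<^sup>+x \<in> {a..<a + t}. (\<Sum>k<m. f (x + real k * t)) \<partial>lborel)
      + (\<integral>\<^sup>+x \<in> {a..<a + t}. f (x + real m * t) \<partial>lborel)"
    using Suc.IH shift by (simp add: b_def)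
  also have "\<dots> = (\<integral>\<^sup>+x \<in> {a..<a + t}. (\<Sum>k<Suc m. f (x + real k * t)) \<partial>lborel)"
    by (subst nn_integral_add[symmetric]) (auto simp: distrib_right intro!: nn_integral_cong)
  finally show ?case .
qed

text \<open>Cutting the line into intervals of length \<open>t\<close> and translating them onto one of them turns the
  integral into one of sums over grids of mesh \<open>t\<close>, each bounded by the variation.\<close>

lemma nn_integral_increment_le_pos:
  assumes [measurable]: "f \<in> borel_measurable borel" and "0 < t"
  shows "(\<integral>\<^sup>+x. ennreal \<bar>f (x + t) - f x\<bar> \<partial>lborel) \<le> total_variation f * ennreal t"
proof -
  define g where "g x = ennreal \<bar>f (x + t) - f x\<bar>" for x
  have [measurable]: "g \<in> borel_measurable borel" unfolding g_def by measurable
  \<comment> \<open>The windows \<open>B N\<close> consist of \<open>2 * N\<close> cells and exhaust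
    the line. A bound that does not depend on \<open>N\<close> therefore passes to the whole
    integral by monotone convergence.\<close>
  define B where "B N = {- (real N * t)..<real N * t}" for N
  have "(\<integral>\<^sup>+x \<in> B N. g x \<partial>lborel) \<le> total_variation f * ennreal t" for N
  proof -
    let ?a = "- (real N * t)"
    have "B N = {?a..<?a + real (2 * N) * t}"
      by (simp add: B_def mult.commute)
    then have "(\<integral>\<^sup>+x \<in> B N. g x \<partial>lborel)
        = (\<integral>\<^sup>+x \<in> {?a..<?a + t}. (\<Sum>k<2 * N. g (x + real k * t)) \<partial>lborel)"
      using nn_integral_interval_split[of g t ?a "2 * N"] \<open>0 < t\<close> by simp
    also have "\<dots> \<le> (\<integral>\<^sup>+x \<in> {?a..<?a + t}. total_variation f \<partial>lborel)"
    proof (intro nn_integral_mono mult_right_mono)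
      fix x
      have "mono (\<lambda>k. x + real k * t)"
        using \<open>0 < t\<close> by (auto simp: mono_def)
      from grid_sum_le_total_variation[OF this, where m = "2 * N" and f = f]
      show "(\<Sum>k<2 * N. g (x + real k * t)) \<le> total_variation f"
        by (simp add: g_def algebra_simps)
    qed simp
    also have "\<dots> = total_variation f * ennreal t"
      using \<open>0 < t\<close> by (subst nn_integral_cmult_indicator) auto
    finally show ?thesis .
  qed
  moreover have "(\<integral>\<^sup>+x. g x \<partial>lborel) = (SUP N. \<integral>\<^sup>+x \<in> B N. g x \<partial>lborel)"
  proof -
    have [measurable]: "B N \<in> sets borel" for N
      by (simp add: B_def)
    have sub: "B N \<subseteq> B (Suc N)" for N
      using \<open>0 < t\<close> by (auto simp: B_def algebra_simps)
    have "(SUP N. g x * indicator (B N) x) = g x" for x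
    proof -
      obtain N where "\<bar>x\<bar> / t < real N" using reals_Archimedean2 by blast
      then have "x \<in> B N" using \<open>0 < t\<close> by (auto simp: B_def field_simps abs_less_iff)
      then show ?thesis
        by (intro antisym SUP_least SUP_upper2[of N]) (auto simp: indicator_def)
    qed
    then have "(\<integral>\<^sup>+x. g x \<partial>lborel) = (\<integral>\<^sup>+x. (SUP N. g x * indicator (B N) x) \<partial>lborel)"
      by simp
    also have "\<dots> = (SUP N. \<integral>\<^sup>+x \<in> B N. g x \<partial>lborel)"
      by (rule nn_integral_monotone_convergence_SUP_AE)
         (use sub in \<open>auto simp: indicator_def subset_iff\<close>)
    finally show ?thesis .
  qed
  ultimately show ?thesis
    by (auto simp: g_def intro!: SUP_least)
qed

lemma nn_integral_increment_le:
  assumes [measurable]: "f \<in> borel_measurable borel"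
  shows "(\<integral>\<^sup>+x. ennreal \<bar>f (x + t) - f x\<bar> \<partial>lborel) \<le> total_variation f * ennreal \<bar>t\<bar>"
proof -
  consider "t = 0" | "0 < t" | "t < 0" by linarith
  then show ?thesis
  proof cases
    case 3
    \<comment> \<open>The substitution of \<open>x - t\<close> for \<open>x\<close> exchanges the
      two values of \<open>f\<close>, so a negative step reduces to its opposite.\<close>
    have "(\<integral>\<^sup>+x. ennreal \<bar>f (x + t) - f x\<bar> \<partial>lborel) = (\<integral>\<^sup>+x. ennreal \<bar>f (x + - t) - f x\<bar> \<partial>lborel)"
      by (subst nn_integral_real_affine[where c = 1 and t = "- t"])
         (auto simp: abs_minus_commute add.commute)
    with 3 nn_integral_increment_le_pos[of f "- t"] show ?thesis by simp
  qed (use nn_integral_increment_le_pos[of f t] in auto)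
qed

text \<open>One factor of the square is bounded pointwise by the variation, the other is integrated;
  this is where the bias bound gets its order \<open>h\<close> with no smoothness of the
  density.\<close>

lemma nn_integral_increment_squared_le:
  assumes [measurable]: "f \<in> borel_measurable borel"
  shows "(\<integral>\<^sup>+x. ennreal ((f (x + t) - f x)\<^sup>2) \<partial>lborel) \<le> (total_variation f)\<^sup>2 * ennreal \<bar>t\<bar>"
proof -
  have "(\<integral>\<^sup>+x. ennreal ((f (x + t) - f x)\<^sup>2) \<partial>lborel)
      \<le> (\<integral>\<^sup>+x. total_variation f * ennreal \<bar>f (x + t) - f x\<bar> \<partial>lborel)"
  proof (intro nn_integral_mono)
    fix x
    have "ennreal ((f (x + t) - f x)\<^sup>2) = ennreal \<bar>f (x + t) - f x\<bar> * ennreal \<bar>f (x + t) - f x\<bar>"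
      by (simp add: ennreal_mult[symmetric] power2_eq_square)
    then show "ennreal ((f (x + t) - f x)\<^sup>2) \<le> total_variation f * ennreal \<bar>f (x + t) - f x\<bar>"
      by (simp add: mult_right_mono abs_diff_le_total_variation)
  qed
  also have "\<dots> = total_variation f * (\<integral>\<^sup>+x. ennreal \<bar>f (x + t) - f x\<bar> \<partial>lborel)"
    by (rule nn_integral_cmult) measurable
  also have "\<dots> \<le> total_variation f * (total_variation f * ennreal \<bar>t\<bar>)"
    by (intro mult_left_mono nn_integral_increment_le) auto
  finally show ?thesis by (simp add: power2_eq_square mult.assoc)
qed

section \<open>Mean squared error of a sample mean\<close>

lemma (in prob_space) expectation_sum_squared_indep:
  fixes Y :: "'i \<Rightarrow> 'a \<Rightarrow> real"
  assumes "finite I" "indep_vars (\<lambda>_. borel) Y I"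
    and "\<And>i. i \<in> I \<Longrightarrow> integrable M (\<lambda>\<omega>. (Y i \<omega>)\<^sup>2)"
    and "\<And>i. i \<in> I \<Longrightarrow> expectation (Y i) = 0"
  shows "integrable M (\<lambda>\<omega>. (\<Sum>i\<in>I. Y i \<omega>)\<^sup>2)"
    and "expectation (\<lambda>\<omega>. (\<Sum>i\<in>I. Y i \<omega>)\<^sup>2) = (\<Sum>i\<in>I. expectation (\<lambda>\<omega>. (Y i \<omega>)\<^sup>2))"
proof -
  \<comment> \<open>Both claims go through one induction, since the expectation of the expanded
    square can be split only once its terms are known to be integrable.\<close>
  have "integrable M (\<lambda>\<omega>. (\<Sum>i\<in>I. Y i \<omega>)\<^sup>2) \<and>
      expectation (\<lambda>\<omega>. (\<Sum>i\<in>I. Y i \<omega>)\<^sup>2) = (\<Sum>i\<in>I. expectation (\<lambda>\<omega>. (Y i \<omega>)\<^sup>2))"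
    using assms
  proof (induction I rule: finite_induct)
    case empty
    then show ?case by simp
  next
    case (insert i I)
    let ?S = "\<lambda>\<omega>. \<Sum>i\<in>I. Y i \<omega>"
    have rv: "random_variable borel (Y j)" if "j \<in> insert i I" for j
      using insert.prems(1) that by (auto simp: indep_vars_def2)
    have intY: "integrable M (Y j)" if "j \<in> insert i I" for j
      using square_integrable_imp_integrable[OF rv[OF that]] insert.prems(2)[OF that] by simp
    have IH: "integrable M (\<lambda>\<omega>. (?S \<omega>)\<^sup>2)"
      "expectation (\<lambda>\<omega>. (?S \<omega>)\<^sup>2) = (\<Sum>i\<in>I. expectation (\<lambda>\<omega>. (Y i \<omega>)\<^sup>2))"
      using insert.IH insert.prems indep_vars_subset[OF insert.prems(1), of I] by auto
    have indep: "indep_var borel (Y i) borel ?S"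
      using insert.hyps insert.prems(1) by (rule indep_vars_sum)
    have intS: "integrable M ?S" using intY by auto
    have intYS: "integrable M (\<lambda>\<omega>. Y i \<omega> * ?S \<omega>)"
      using indep_var_integrable[OF indep intY intS] by simp
    \<comment> \<open>The cross term vanishes: \<open>Y i\<close> is independent of the partial sum
      and has mean zero.\<close>
    have "expectation (\<lambda>\<omega>. Y i \<omega> * ?S \<omega>) = 0"
      using indep_var_lebesgue_integral[OF indep intY intS] insert.prems(3) by simp
    then show ?case
      using insert.hyps IH intYS insert.prems(2)
      by (simp add: power2_sum mult.assoc)
  qed
  then show "integrable M (\<lambda>\<omega>. (\<Sum>i\<in>I. Y i \<omega>)\<^sup>2)"
    and "expectation (\<lambda>\<omega>. (\<Sum>i\<in>I. Y i \<omega>)\<^sup>2) = (\<Sum>i\<in>I. expectation (\<lambda>\<omega>. (Y i \<omega>)\<^sup>2))"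
    by auto
qed

text \<open>The bias-variance decomposition about an arbitrary centre \<open>c\<close>, with the
  variance \<open>s - m^2\<close> of one summand relaxed to its second moment \<open>s\<close>. It
  is applied with \<open>c\<close> equal to \<open>p x\<close>.\<close>

lemma (in prob_space) sample_mean_squared_error_le:
  fixes Y :: "nat \<Rightarrow> 'a \<Rightarrow> real"
  assumes indep: "indep_vars (\<lambda>_. borel) Y {1..n}" and "0 < n"
    and sq: "\<And>j. j \<in> {1..n} \<Longrightarrow> integrable M (\<lambda>\<omega>. (Y j \<omega>)\<^sup>2)"
    and mean: "\<And>j. j \<in> {1..n} \<Longrightarrow> expectation (Y j) = m"
    and second: "\<And>j. j \<in> {1..n} \<Longrightarrow> expectation (\<lambda>\<omega>. (Y j \<omega>)\<^sup>2) = s"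
  shows "integrable M (\<lambda>\<omega>. (1 / real n * (\<Sum>j=1..n. Y j \<omega>) - c)\<^sup>2)" (is ?int)
    and "expectation (\<lambda>\<omega>. (1 / real n * (\<Sum>j=1..n. Y j \<omega>) - c)\<^sup>2) \<le> s / real n + (m - c)\<^sup>2" (is ?le)
proof -
  have rv: "random_variable borel (Y j)" if "j \<in> {1..n}" for j
    using indep that by (auto simp: indep_vars_def2)
  have intY: "integrable M (Y j)" if "j \<in> {1..n}" for j
    using square_integrable_imp_integrable[OF rv[OF that]] sq[OF that] by simp
  define Z where "Z j \<omega> = Y j \<omega> - m" for j \<omega>
  define S where "S \<omega> = (\<Sum>j=1..n. Z j \<omega>)" for \<omega>
  have indepZ: "indep_vars (\<lambda>_. borel) Z {1..n}"
    unfolding Z_def by (rule indep_vars_compose2[OF indep]) auto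
  have intZ: "integrable M (Z j)" if "j \<in> {1..n}" for j
    unfolding Z_def using intY[OF that] by simp
  have sqZ: "integrable M (\<lambda>\<omega>. (Z j \<omega>)\<^sup>2)" if "j \<in> {1..n}" for j
    unfolding Z_def power2_diff using intY[OF that] sq[OF that] by simp
  have meanZ: "expectation (Z j) = 0" if "j \<in> {1..n}" for j
    unfolding Z_def using intY[OF that] mean[OF that] by (simp add: prob_space)
  have secondZ: "expectation (\<lambda>\<omega>. (Z j \<omega>)\<^sup>2) \<le> s" if "j \<in> {1..n}" for j
    using variance_eq[OF intY[OF that] sq[OF that]] mean[OF that] second[OF that]
    by (simp add: Z_def)
  have intS: "integrable M S" and meanS: "expectation S = 0"
    unfolding S_def using intZ meanZ by (auto simp: Bochner_Integration.integral_sum)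
  have sqS: "integrable M (\<lambda>\<omega>. (S \<omega>)\<^sup>2)"
    unfolding S_def using expectation_sum_squared_indep(1)[OF _ indepZ sqZ meanZ] by auto
  have "expectation (\<lambda>\<omega>. (S \<omega>)\<^sup>2) = (\<Sum>j=1..n. expectation (\<lambda>\<omega>. (Z j \<omega>)\<^sup>2))"
    unfolding S_def using expectation_sum_squared_indep(2)[OF _ indepZ sqZ meanZ] by auto
  also have "\<dots> \<le> real n * s"
    using sum_bounded_above[of "{1..n}" "\<lambda>j. expectation (\<lambda>\<omega>. (Z j \<omega>)\<^sup>2)" s] secondZ by simp
  finally have secondS: "expectation (\<lambda>\<omega>. (S \<omega>)\<^sup>2) \<le> real n * s" .
  \<comment> \<open>The error is \<open>S / n\<close> plus the constant bias \<open>m - c\<close>;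
    after squaring, the mixed term is linear in \<open>S\<close> and has mean zero.\<close>
  have eq: "(\<lambda>\<omega>. (1 / real n * (\<Sum>j=1..n. Y j \<omega>) - c)\<^sup>2)
      = (\<lambda>\<omega>. (S \<omega>)\<^sup>2 / (real n)\<^sup>2 + (m - c)\<^sup>2 + 2 * (m - c) / real n * S \<omega>)"
  proof
    fix \<omega>
    have "1 / real n * (\<Sum>j=1..n. Y j \<omega>) - c = S \<omega> / real n + (m - c)"
      using \<open>0 < n\<close> by (simp add: S_def Z_def sum_subtractf field_simps)
    then show "(1 / real n * (\<Sum>j=1..n. Y j \<omega>) - c)\<^sup>2
        = (S \<omega>)\<^sup>2 / (real n)\<^sup>2 + (m - c)\<^sup>2 + 2 * (m - c) / real n * S \<omega>"
      by (simp only: power2_sum) (simp add: power_divide)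
  qed
  show ?int
    unfolding eq using intS sqS by auto
  have "expectation (\<lambda>\<omega>. (1 / real n * (\<Sum>j=1..n. Y j \<omega>) - c)\<^sup>2)
      = expectation (\<lambda>\<omega>. (S \<omega>)\<^sup>2) / (real n)\<^sup>2 + (m - c)\<^sup>2"
    unfolding eq using intS sqS meanS by (simp add: prob_space)
  also have "\<dots> \<le> real n * s / (real n)\<^sup>2 + (m - c)\<^sup>2"
    using secondS by (simp add: divide_right_mono)
  also have "real n * s / (real n)\<^sup>2 = s / real n"
    by (simp add: power2_eq_square)
  finally show ?le .
qed

section \<open>Mean squared error of the estimator at a point\<close>

lemma prob_density_prob_space:
  assumes "prob_density f"
  shows "prob_space (density lborel (\<lambda>x. ennreal (f x)))"
proof (rule prob_spaceI)
  have [measurable]: "f \<in> borel_measurable borel"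
    using assms by (simp add: prob_density_def)
  show "emeasure (density lborel (\<lambda>x. ennreal (f x))) (space (density lborel (\<lambda>x. ennreal (f x)))) = 1"
    using assms by (simp add: emeasure_density prob_density_def)
qed

text \<open>The first term bounds the variance, the second the squared bias. Both remain nonnegative
  extended integrals, ready for exchanging the order of integration once \<open>x\<close>
  varies.\<close>

lemma kernel_estimator_mean_squared_error_le:
  assumes M: "prob_space M" and p: "prob_density p" and iid: "iid_density M n X p"
    and K: "prob_density K" and K2: "integrable lborel (\<lambda>x. (K x)\<^sup>2)"
    and TV: "total_variation p < \<infinity>" and "0 < h" and "0 < n"
  shows "(\<integral>\<^sup>+\<omega>. ennreal ((kernel_estimator K n h X \<omega> x - p x)\<^sup>2) \<partial>M)
    \<le> ennreal (1 / real n) * (\<integral>\<^sup>+y. ennreal (p y) * ennreal ((scaled_kernel K h (x - y))\<^sup>2) \<partial>lborel)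
      + (\<integral>\<^sup>+u. ennreal (K u) * ennreal ((p (x + - (h * u)) - p x)\<^sup>2) \<partial>lborel)"
proof -
  interpret prob_space M by fact
  interpret N: prob_space "density lborel (\<lambda>x. ennreal (K x))"
    using K by (rule prob_density_prob_space)
  have [measurable]: "p \<in> borel_measurable borel" "K \<in> borel_measurable borel"
    and p0: "\<And>y. 0 \<le> p y" and K0: "\<And>y. 0 \<le> K y"
    using p K by (auto simp: prob_density_def)
  \<comment> \<open>A density of bounded variation is bounded, as it stays within \<open>V\<close>
    of \<open>p 0\<close>. This makes \<open>p y * (g y)^2\<close> integrable and the increments
    \<open>q\<close> below bounded.\<close>
  obtain B where B: "\<And>y. p y \<le> B" "0 \<le> B"
  proof -
    obtain V where V: "total_variation p = ennreal V" "0 \<le> V"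
      using TV by (cases "total_variation p") auto
    have "\<bar>p y - p 0\<bar> \<le> V" for y
      using abs_diff_le_total_variation[of p y 0] V by simp
    then have "p y \<le> p 0 + V" for y
      by (smt (verit))
    then show ?thesis using that[of "p 0 + V"] p0[of 0] V by simp
  qed
  define g where "g y = scaled_kernel K h (x - y)" for y
  have g_eq: "g y = inverse h * K (x / h + (- 1 / h) * y)" for y
    by (simp add: g_def scaled_kernel_def divide_inverse algebra_simps)
  have [measurable]: "g \<in> borel_measurable borel"
    unfolding g_eq by measurable
  have "integrable lborel (\<lambda>y. (K (x / h + (- 1 / h) * y))\<^sup>2)"
    by (rule lborel_integrable_real_affine[OF K2]) (use \<open>0 < h\<close> in auto)
  then have g2: "integrable lborel (\<lambda>y. (g y)\<^sup>2)"
    by (simp add: g_eq power_mult_distrib)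
  have pg2: "integrable lborel (\<lambda>y. p y * (g y)\<^sup>2)"
  proof (rule Bochner_Integration.integrable_bound)
    show "integrable lborel (\<lambda>y. B * (g y)\<^sup>2)" using g2 by simp
    show "AE y in lborel. norm (p y * (g y)\<^sup>2) \<le> norm (B * (g y)\<^sup>2)"
      using B p0 by (auto simp: abs_mult intro!: mult_right_mono)
  qed measurable
  define s where "s = (\<integral>y. p y * (g y)\<^sup>2 \<partial>lborel)"
  define m where "m = (\<integral>y. p y * g y \<partial>lborel)"
  have D: "distributed M lborel (X j) (\<lambda>x. ennreal (p x))" if "j \<in> {1..n}" for j
    using iid that by (simp add: iid_density_def)
  have indep: "indep_vars (\<lambda>_. borel) (\<lambda>j \<omega>. g (X j \<omega>)) {1..n}"
    by (rule indep_vars_compose2[where M' = "\<lambda>_. borel" and X = X and Y = "\<lambda>_. g"])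
      (use iid in \<open>simp_all add: iid_density_def\<close>)
  have sq: "integrable M (\<lambda>\<omega>. (g (X j \<omega>))\<^sup>2)" if "j \<in> {1..n}" for j
    using distributed_integrable[OF D[OF that], of "\<lambda>y. (g y)\<^sup>2"] pg2 p0 by simp
  have mean: "expectation (\<lambda>\<omega>. g (X j \<omega>)) = m" if "j \<in> {1..n}" for j
    using distributed_integral[OF D[OF that], of g] p0 by (simp add: m_def)
  have second: "expectation (\<lambda>\<omega>. (g (X j \<omega>))\<^sup>2) = s" if "j \<in> {1..n}" for j
    using distributed_integral[OF D[OF that], of "\<lambda>y. (g y)\<^sup>2"] p0 by (simp add: s_def)

  define q where "q u = p (x + - (h * u)) - p x" for u
  have [measurable]: "q \<in> borel_measurable borel"
    unfolding q_def by measurable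
  have qB: "\<bar>q u\<bar> \<le> B" for u
    using B(1)[of "x + - (h * u)"] B(1)[of x] p0[of "x + - (h * u)"] p0[of x]
    unfolding q_def by linarith
  have q1: "integrable (density lborel (\<lambda>x. ennreal (K x))) q"
    by (rule N.integrable_const_bound[where B = B]) (use qB in auto)
  have q2: "integrable (density lborel (\<lambda>x. ennreal (K x))) (\<lambda>u. (q u)\<^sup>2)"
  proof (rule N.integrable_const_bound[where B = "B\<^sup>2"])
    have "(q u)\<^sup>2 \<le> B\<^sup>2" for u
      using power_mono[OF qB[of u], of 2] by simp
    then show "AE u in density lborel (\<lambda>x. ennreal (K x)). norm ((q u)\<^sup>2) \<le> B\<^sup>2"
      by simp
  qed measurable
  \<comment> \<open>With \<open>y = x - h * u\<close> the mean \<open>m\<close> becomes the average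
    of \<open>p (x - h * u)\<close> under the density \<open>K\<close>; the Jacobian
    \<open>h\<close> cancels the factor \<open>inverse h\<close> of the scaled kernel.\<close>
  have "m = h * (\<integral>u. p (x + (- h) * u) * g (x + (- h) * u) \<partial>lborel)"
    unfolding m_def using \<open>0 < h\<close>
    by (subst lborel_integral_real_affine[where c = "- h" and t = x]) auto
  also have "\<dots> = (\<integral>u. h * (p (x + (- h) * u) * g (x + (- h) * u)) \<partial>lborel)"
    by simp
  also have "\<dots> = (\<integral>u. K u * p (x + - (h * u)) \<partial>lborel)"
    using \<open>0 < h\<close>
    by (intro Bochner_Integration.integral_cong)
      (auto simp: g_def scaled_kernel_def mult.assoc[symmetric])
  also have "\<dots> = N.expectation (\<lambda>u. q u + p x)"
    by (subst integral_real_density) (auto simp: q_def K0)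
  also have "\<dots> = N.expectation q + p x"
    using q1 N.prob_space by simp
  finally have bias: "m - p x = N.expectation q" by simp
  \<comment> \<open>Jensen's inequality for the square, read as nonnegativity of the variance of
    \<open>q\<close> under the law with density \<open>K\<close>.\<close>
  have "(m - p x)\<^sup>2 \<le> N.expectation (\<lambda>u. (q u)\<^sup>2)"
    using N.variance_eq[OF q1 q2] N.variance_positive[of q] bias by simp
  then have "ennreal ((m - p x)\<^sup>2) \<le> ennreal (N.expectation (\<lambda>u. (q u)\<^sup>2))"
    by (rule ennreal_leI)
  also have "\<dots> = (\<integral>\<^sup>+u. ennreal ((q u)\<^sup>2) \<partial>density lborel (\<lambda>x. ennreal (K x)))"
    using q2 by (intro nn_integral_eq_integral[symmetric]) auto
  also have "\<dots> = (\<integral>\<^sup>+u. ennreal (K u) * ennreal ((q u)\<^sup>2) \<partial>lborel)"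
    by (rule nn_integral_density) measurable
  finally have bias2: "ennreal ((m - p x)\<^sup>2) \<le> (\<integral>\<^sup>+u. ennreal (K u) * ennreal ((q u)\<^sup>2) \<partial>lborel)" .
  have s: "ennreal s = (\<integral>\<^sup>+y. ennreal (p y) * ennreal ((g y)\<^sup>2) \<partial>lborel)"
    unfolding s_def using pg2 p0
    by (subst nn_integral_eq_integral[symmetric]) (auto simp: ennreal_mult)
  have s0: "0 \<le> s" unfolding s_def using p0 by (auto intro!: integral_nonneg_AE)

  have est: "kernel_estimator K n h X \<omega> x = 1 / real n * (\<Sum>j=1..n. g (X j \<omega>))" for \<omega>
    by (simp add: kernel_estimator_def g_def)
  have "(\<integral>\<^sup>+\<omega>. ennreal ((kernel_estimator K n h X \<omega> x - p x)\<^sup>2) \<partial>M)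
      = ennreal (expectation (\<lambda>\<omega>. (kernel_estimator K n h X \<omega> x - p x)\<^sup>2))"
    unfolding est by (rule nn_integral_eq_integral[OF sample_mean_squared_error_le(1)])
      (use indep \<open>0 < n\<close> sq mean second in auto)
  also have "\<dots> \<le> ennreal (s / real n + (m - p x)\<^sup>2)"
    unfolding est by (rule ennreal_leI, rule sample_mean_squared_error_le(2))
      (use indep \<open>0 < n\<close> sq mean second in auto)
  also have "\<dots> = ennreal (1 / real n) * ennreal s + ennreal ((m - p x)\<^sup>2)"
    using s0 by (simp add: ennreal_mult[symmetric])
  also have "\<dots> \<le> ennreal (1 / real n) * ennreal s + (\<integral>\<^sup>+u. ennreal (K u) * ennreal ((q u)\<^sup>2) \<partial>lborel)"
    by (intro add_left_mono bias2)
  finally show ?thesis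
    by (simp add: s g_def q_def)
qed

section \<open>Integration over the line and the bound for a general bandwidth\<close>

lemma nn_integral_scaled_kernel_squared:
  assumes [measurable]: "K \<in> borel_measurable borel"
    and K2: "integrable lborel (\<lambda>x. (K x)\<^sup>2)" and "0 < h"
  shows "(\<integral>\<^sup>+x. ennreal ((scaled_kernel K h (x - y))\<^sup>2) \<partial>lborel) = ennreal (roughness K / h)"
proof -
  have [measurable]: "scaled_kernel K h \<in> borel_measurable borel"
    unfolding scaled_kernel_def by measurable
  have "(\<integral>\<^sup>+x. ennreal ((scaled_kernel K h (x - y))\<^sup>2) \<partial>lborel)
      = ennreal h * (\<integral>\<^sup>+u. ennreal ((scaled_kernel K h (h * u))\<^sup>2) \<partial>lborel)"
    \<comment> \<open>Substituting \<open>x = y + h * u\<close> removes \<open>y\<close> altogether;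
      the Jacobian \<open>h\<close> against the squared factor \<open>inverse h\<close> leaves
      \<open>1 / h\<close>.\<close>
    using \<open>0 < h\<close> by (subst nn_integral_real_affine[where c = h and t = y]) auto
  also have "(\<integral>\<^sup>+u. ennreal ((scaled_kernel K h (h * u))\<^sup>2) \<partial>lborel)
      = (\<integral>\<^sup>+u. ennreal ((inverse h)\<^sup>2) * ennreal ((K u)\<^sup>2) \<partial>lborel)"
    using \<open>0 < h\<close>
    by (intro nn_integral_cong)
      (simp add: scaled_kernel_def power_mult_distrib ennreal_mult mult.assoc[symmetric])
  also have "\<dots> = ennreal ((inverse h)\<^sup>2) * ennreal (roughness K)"
    using K2 by (simp add: nn_integral_cmult nn_integral_eq_integral roughness_def)
  also have "ennreal h * \<dots> = ennreal (h * ((inverse h)\<^sup>2 * roughness K))"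
    using \<open>0 < h\<close> by (simp add: ennreal_mult roughness_def)
  also have "h * ((inverse h)\<^sup>2 * roughness K) = roughness K / h"
    using \<open>0 < h\<close> by (simp add: power2_eq_square field_simps)
  finally show ?thesis .
qed

text \<open>Integrates the pointwise bound over \<open>x\<close>. The variance part is of order
  \<open>1 / (n * h)\<close> and the bias part of order \<open>h\<close>, for every positive
  bandwidth and sample size.\<close>

proposition MISE_kernel_estimator_le:
  assumes M: "prob_space M" and p: "prob_density p" and iid: "iid_density M n X p"
    and K: "prob_density K" and K2: "integrable lborel (\<lambda>x. (K x)\<^sup>2)"
    and K1: "integrable lborel (\<lambda>x. \<bar>x\<bar> * K x)"
    and V: "total_variation p = ennreal V" "0 \<le> V" and "0 < h" and "0 < n"
  shows "MISE M (kernel_estimator K n h X) p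
    \<le> ennreal (roughness K / (real n * h) + V\<^sup>2 * abs_moment1 K * h)"
proof -
  interpret prob_space M by fact
  interpret pair_sigma_finite M lborel ..
  have [measurable]: "p \<in> borel_measurable borel" "K \<in> borel_measurable borel"
    and p1: "(\<integral>\<^sup>+y. ennreal (p y) \<partial>lborel) = 1"
    and p0: "\<And>y. 0 \<le> p y" and K0: "\<And>y. 0 \<le> K y"
    using p K by (auto simp: prob_density_def)
  have [measurable]: "scaled_kernel K h \<in> borel_measurable borel"
    unfolding scaled_kernel_def by measurable
  have X: "X j \<in> borel_measurable M" if "j \<in> {1..n}" for j
    using iid that by (auto simp: iid_density_def indep_vars_def2)
  \<comment> \<open>Tonelli's theorem requires joint measurability. It is checked summand by summand
    because \<open>X j\<close> is known to be measurable only for \<open>j\<close> in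
    \<open>{1..n}\<close>.\<close>
  have [measurable]: "(\<lambda>(\<omega>, x). kernel_estimator K n h X \<omega> x) \<in> borel_measurable (M \<Otimes>\<^sub>M lborel)"
    unfolding kernel_estimator_def case_prod_beta
  proof (intro borel_measurable_times borel_measurable_const borel_measurable_sum)
    fix j assume "j \<in> {1..n}"
    note X[OF this, measurable]
    show "(\<lambda>z. scaled_kernel K h (snd z - X j (fst z))) \<in> borel_measurable (M \<Otimes>\<^sub>M lborel)"
      by measurable
  qed
  have "MISE M (kernel_estimator K n h X) p
      = (\<integral>\<^sup>+x. (\<integral>\<^sup>+\<omega>. ennreal ((kernel_estimator K n h X \<omega> x - p x)\<^sup>2) \<partial>M) \<partial>lborel)"
    unfolding MISE_def by (rule Fubini'[symmetric]) measurable
  also have "\<dots> \<le> (\<integral>\<^sup>+x.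
      ennreal (1 / real n) * (\<integral>\<^sup>+y. ennreal (p y) * ennreal ((scaled_kernel K h (x - y))\<^sup>2) \<partial>lborel)
      + (\<integral>\<^sup>+u. ennreal (K u) * ennreal ((p (x + - (h * u)) - p x)\<^sup>2) \<partial>lborel) \<partial>lborel)"
    by (intro nn_integral_mono kernel_estimator_mean_squared_error_le) (use assms in auto)
  also have "\<dots> = ennreal (1 / real n) *
        (\<integral>\<^sup>+x. (\<integral>\<^sup>+y. ennreal (p y) * ennreal ((scaled_kernel K h (x - y))\<^sup>2) \<partial>lborel) \<partial>lborel)
      + (\<integral>\<^sup>+x. (\<integral>\<^sup>+u. ennreal (K u) * ennreal ((p (x + - (h * u)) - p x)\<^sup>2) \<partial>lborel) \<partial>lborel)"
    by (subst nn_integral_add) (auto simp: nn_integral_cmult)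
  \<comment> \<open>With \<open>x\<close> innermost, the kernel integral is the same for all
    \<open>y\<close>, and \<open>p\<close> then integrates to one.\<close>
  also have "(\<integral>\<^sup>+x. (\<integral>\<^sup>+y. ennreal (p y) * ennreal ((scaled_kernel K h (x - y))\<^sup>2) \<partial>lborel) \<partial>lborel)
      = (\<integral>\<^sup>+y. (\<integral>\<^sup>+x. ennreal (p y) * ennreal ((scaled_kernel K h (x - y))\<^sup>2) \<partial>lborel) \<partial>lborel)"
    by (rule lborel_pair.Fubini'[symmetric]) measurable
  also have "\<dots> = (\<integral>\<^sup>+y. ennreal (p y) * ennreal (roughness K / h) \<partial>lborel)"
    using \<open>0 < h\<close> K2 by (simp add: nn_integral_cmult nn_integral_scaled_kernel_squared)
  also have "\<dots> = ennreal (roughness K / h)"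
    by (simp add: nn_integral_multc p1)
  \<comment> \<open>With \<open>x\<close> innermost, \<open>u\<close> fixes the step
    \<open>- (h * u)\<close> of the increment, so the bound \<open>V^2 * h * |u|\<close> applies and
    \<open>K\<close> averages it to the first absolute moment.\<close>
  also have "(\<integral>\<^sup>+x. (\<integral>\<^sup>+u. ennreal (K u) * ennreal ((p (x + - (h * u)) - p x)\<^sup>2) \<partial>lborel) \<partial>lborel)
      = (\<integral>\<^sup>+u. (\<integral>\<^sup>+x. ennreal (K u) * ennreal ((p (x + - (h * u)) - p x)\<^sup>2) \<partial>lborel) \<partial>lborel)"
    by (rule lborel_pair.Fubini'[symmetric]) measurable
  also have "\<dots> \<le> (\<integral>\<^sup>+u. ennreal (V\<^sup>2 * h) * ennreal (\<bar>u\<bar> * K u) \<partial>lborel)"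
  proof (intro nn_integral_mono)
    fix u
    have "(\<integral>\<^sup>+x. ennreal (K u) * ennreal ((p (x + - (h * u)) - p x)\<^sup>2) \<partial>lborel)
        = ennreal (K u) * (\<integral>\<^sup>+x. ennreal ((p (x + - (h * u)) - p x)\<^sup>2) \<partial>lborel)"
      by (rule nn_integral_cmult) measurable
    also have "\<dots> \<le> ennreal (K u) * ((total_variation p)\<^sup>2 * ennreal \<bar>- (h * u)\<bar>)"
      by (intro mult_left_mono nn_integral_increment_squared_le) auto
    also have "\<dots> = ennreal (V\<^sup>2 * h) * ennreal (\<bar>u\<bar> * K u)"
      using V \<open>0 < h\<close> K0[of u]
      by (simp add: ennreal_mult[symmetric] ennreal_power abs_mult mult_ac)
    finally show "(\<integral>\<^sup>+x. ennreal (K u) * ennreal ((p (x + - (h * u)) - p x)\<^sup>2) \<partial>lborel)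
        \<le> ennreal (V\<^sup>2 * h) * ennreal (\<bar>u\<bar> * K u)" .
  qed
  also have "\<dots> = ennreal (V\<^sup>2 * h) * ennreal (abs_moment1 K)"
    using K1 K0 by (simp add: nn_integral_cmult nn_integral_eq_integral abs_moment1_def)
  also have "ennreal (1 / real n) * ennreal (roughness K / h) + ennreal (V\<^sup>2 * h) * ennreal (abs_moment1 K)
      = ennreal (roughness K / (real n * h) + V\<^sup>2 * abs_moment1 K * h)"
  proof -
    have "0 \<le> roughness K" "0 \<le> abs_moment1 K"
      using K0 by (auto simp: roughness_def abs_moment1_def intro!: integral_nonneg_AE)
    then show ?thesis
      using \<open>0 < h\<close> by (simp add: ennreal_mult[symmetric] ennreal_plus[symmetric] mult_ac del: ennreal_plus)
  qed
  finally show ?thesis by (auto intro: add_left_mono)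
qed

section \<open>The prescribed bandwidth\<close>

theorem theorem5:
  fixes M :: "'a measure" and X :: "nat \<Rightarrow> 'a \<Rightarrow> real"
    and p K :: "real \<Rightarrow> real" and n :: nat and h h0 V :: real
  assumes "prob_space M"
    and "prob_density p"
    and "iid_density M n X p"
    and "prob_density K"
    and "integrable lborel (\<lambda>x. (K x)\<^sup>2)"
    and "integrable lborel (\<lambda>x. \<bar>x\<bar> * K x)"
    and "total_variation p < \<infinity>"
    and "V = enn2real (total_variation p)"
    and "h0 > 0"
    and "n \<ge> 16"
    and "h = h0 / (sqrt (real n) * ln (real n))"
  shows "MISE M (kernel_estimator K n h X) p
    \<le> ennreal ((ln (real n))\<^sup>2 / sqrt (real n) *
        (4 * sqrt 2 / pi * max (sqrt (abs_moment1 K)) (abs_moment1 K)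
            * max (V powr (3 / 2)) (V\<^sup>2) * max (sqrt h0) h0
         + roughness K / (h0 * ln (real n))))"
proof -
  define L r \<mu> where "L = ln (real n)" and "r = sqrt (real n)" and "\<mu> = abs_moment1 K"
  have "16 \<le> real n"
    using \<open>n \<ge> 16\<close> by simp
  then have "exp 1 \<le> real n"
    \<comment> \<open>\<open>exp_le\<close> gives \<open>exp 1 <= 3\<close>; hence the logarithm
      \<open>L\<close> is at least one.\<close>
    using exp_le by linarith
  then have "1 \<le> L"
    using \<open>n \<ge> 16\<close> by (simp add: L_def ln_ge_iff)
  have "0 < r" "real n = r * r"
    using \<open>n \<ge> 16\<close> by (auto simp: r_def)
  have h: "h = h0 / (r * L)"
    using assms(11) by (simp add: L_def r_def)
  then have "0 < h"
    using \<open>h0 > 0\<close> \<open>0 < r\<close> \<open>1 \<le> L\<close> by simp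
  have "0 \<le> \<mu>"
    using assms(4) by (auto simp: \<mu>_def abs_moment1_def prob_density_def intro!: integral_nonneg_AE)
  have TV: "total_variation p = ennreal V" "0 \<le> V"
    using assms(7,8) by auto
  \<comment> \<open>The stated constant only has to be at least one: each maximum already dominates
    the matching factor \<open>\<mu>\<close>, \<open>V^2\<close> or \<open>h0\<close> of the bias
    bound.\<close>
  have "1 \<le> 4 * sqrt 2 / pi"
  proof -
    have "pi \<le> 4 * 1" using pi_less_4 by simp
    also have "\<dots> \<le> 4 * sqrt 2" by simp
    finally show ?thesis by (simp add: field_simps)
  qed
  then have const: "1 * \<mu> * V\<^sup>2 * h0
      \<le> 4 * sqrt 2 / pi * max (sqrt \<mu>) \<mu> * max (V powr (3 / 2)) (V\<^sup>2) * max (sqrt h0) h0"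
    using \<open>0 \<le> \<mu>\<close> \<open>h0 > 0\<close>
    by (intro mult_mono mult_nonneg_nonneg) (auto simp: le_max_iff_disj)
  \<comment> \<open>The bias bound carries \<open>1 / L\<close> where the claim allows
    \<open>L^2\<close>; this is the spare factor of order \<open>L^3\<close>.\<close>
  have "1 / L \<le> 1" "1 \<le> L\<^sup>2"
    using \<open>1 \<le> L\<close> by simp_all
  then have "1 / L * (\<mu> * V\<^sup>2 * h0 / r) \<le> L\<^sup>2 * (\<mu> * V\<^sup>2 * h0 / r)"
    using \<open>0 \<le> \<mu>\<close> \<open>h0 > 0\<close> \<open>0 < r\<close> by (intro mult_right_mono) auto
  then have "V\<^sup>2 * \<mu> * h \<le> L\<^sup>2 / r * (1 * \<mu> * V\<^sup>2 * h0)"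
    by (simp add: h mult_ac)
  also have "\<dots> \<le> L\<^sup>2 / r * (4 * sqrt 2 / pi * max (sqrt \<mu>) \<mu>
      * max (V powr (3 / 2)) (V\<^sup>2) * max (sqrt h0) h0)"
    using \<open>0 < r\<close> by (intro mult_left_mono const) simp
  finally have bias: "V\<^sup>2 * \<mu> * h \<le> L\<^sup>2 / r * (4 * sqrt 2 / pi * max (sqrt \<mu>) \<mu>
      * max (V powr (3 / 2)) (V\<^sup>2) * max (sqrt h0) h0)" .
  \<comment> \<open>The variance term matches exactly: since \<open>n = r * r\<close>, the product
    \<open>n * h\<close> equals \<open>r * h0 / L\<close>.\<close>
  have "roughness K / (real n * h) = L\<^sup>2 / r * (roughness K / (h0 * L))"
    using \<open>0 < r\<close> \<open>1 \<le> L\<close> \<open>h0 > 0\<close> by (simp add: h \<open>real n = r * r\<close> power2_eq_square field_simps)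
  with bias have "roughness K / (real n * h) + V\<^sup>2 * \<mu> * h
      \<le> L\<^sup>2 / r * (4 * sqrt 2 / pi * max (sqrt \<mu>) \<mu> * max (V powr (3 / 2)) (V\<^sup>2) * max (sqrt h0) h0
          + roughness K / (h0 * L))"
    by (simp only: distrib_left)
  then show ?thesis
    using MISE_kernel_estimator_le[OF assms(1-6) TV \<open>0 < h\<close>] \<open>n \<ge> 16\<close>
    unfolding L_def r_def \<mu>_def by (auto intro: order_trans ennreal_leI)
qed

end
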